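(* For each $k\ge 1$ define a linear functional $\varphi_k$ on the vector space of polynomials in $s$ by $\varphi_k(F_{2n-1}(s))=T(n,k)$ for all $n\ge 1$. Then for all integers $n,k\ge 0$: $$\varphi_{k+1}(s^n)=LS(n,k),$$ $$\varphi_{k+1}(F_{2n+1}(s))=\sum_{j=0}^{n}\binom{2n-j}{j}LS(j,k)=T(n+1,k+1),$$ $$\varphi_{k+1}(F_{2n+2}(s))=\sum_{j=0}^{n}\binom{2n+1-j}{j}LS(j,k)=(k+1)\,T(n+1,k+1).$$
   Context: The Fibonacci polynomials are $F_0(s)=0$, $F_1(s)=1$, $F_n(s)=F_{n-1}(s)+sF_{n-2}(s)$, i.e. $F_n(s)=\sum_{k=0}^{\lfloor (n-1)/2\rfloor}\binom{n-1-k}{k}s^k$ for $n\ge 1$. Since $\deg F_{2n+1}=n$, the polynomials $F_{2n-1}(s)$, $n\ge1$, form a basis of the vector space of polynomials in $s$ (say with real coefficients), so each $\varphi_k$ is well defined. With $[P]=1$ if $P$ holds and $0$ otherwise: the central factorial numbers of the second kind are defined by $T(0,k)=[k=0]$, $T(n,0)=0$ for $n\ge1$, $T(n,k)=T(n-1,k-1)+k^2T(n-1,k)$ for $n,k\ge1$; the Legendre-Stirling numbers (of the second kind) are defined by $LS(0,k)=[k=0]$, $LS(n,0)=0$ for $n\ge1$, $LS(n,k)=LS(n-1,k-1)+k(k+1)LS(n-1,k)$ for $n,k\ge1$. *)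

theory Defs
  imports Complex_Main "HOL-Computational_Algebra.Polynomial"
begin

fun fib_poly :: "nat \<Rightarrow> real poly" where
  "fib_poly 0 = 0"
| "fib_poly (Suc 0) = 1"
| "fib_poly (Suc (Suc n)) = fib_poly (Suc n) + [:0, 1:] * fib_poly n"

text \<open>Central factorial numbers of the second kind.\<close>

fun central_factorial :: "nat \<Rightarrow> nat \<Rightarrow> nat" where
  "central_factorial 0 k = (if k = 0 then 1 else 0)"
| "central_factorial (Suc n) 0 = 0"
| "central_factorial (Suc n) (Suc k) =
     central_factorial n k + (Suc k)\<^sup>2 * central_factorial n (Suc k)"

text \<open>Legendre-Stirling numbers of the second kind.\<close>

fun legendre_stirling :: "nat \<Rightarrow> nat \<Rightarrow> nat" where
  "legendre_stirling 0 k = (if k = 0 then 1 else 0)"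
| "legendre_stirling (Suc n) 0 = 0"
| "legendre_stirling (Suc n) (Suc k) =
     legendre_stirling n k + Suc k * (Suc k + 1) * legendre_stirling n (Suc k)"

abbreviation poly_functional :: "(real poly \<Rightarrow> real) \<Rightarrow> bool" where
  "poly_functional \<equiv> Vector_Spaces.linear smult (*)"

text \<open>The functional is only meant for \<open>k \<ge> 1\<close>. It exists and is unique because the polynomials
  \<open>fib_poly (2 * n - 1)\<close>, \<open>n \<ge> 1\<close>, form a basis; see \<open>phi_ex1\<close> below.\<close>

definition phi :: "nat \<Rightarrow> real poly \<Rightarrow> real" where
  "phi k = (THE f. poly_functional f \<and>
     (\<forall>n\<ge>1. f (fib_poly (2 * n - 1)) = real (central_factorial n k)))"

lemma poly_functional_iff:
  "poly_functional f \<longleftrightarrow>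
     (\<forall>p q. f (p + q) = f p + f q) \<and> (\<forall>c p. f (smult c p) = c * f p)"
proof -
  have "vector_space (smult :: real \<Rightarrow> real poly \<Rightarrow> real poly)"
    by unfold_locales (simp_all add: smult_add_right smult_add_left)
  moreover have "vector_space ((*) :: real \<Rightarrow> real \<Rightarrow> real)"
    by unfold_locales (simp_all add: algebra_simps)
  ultimately show ?thesis
    by (auto simp: Vector_Spaces.linear_iff)
qed

lemma coeff_fib_poly_odd_even:
  "(\<forall>i>n. coeff (fib_poly (2 * n + 1)) i = 0) \<and> coeff (fib_poly (2 * n + 1)) n = 1 \<and>
   (\<forall>i>n. coeff (fib_poly (2 * n + 2)) i = 0)"
proof (induction n)
  case 0
  show ?case by (auto simp: numeral_2_eq_2 coeff_pCons split: nat.splits)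
next
  case (Suc n)
  have 1: "fib_poly (2 * Suc n + 1) = fib_poly (2 * n + 2) + [:0, 1:] * fib_poly (2 * n + 1)"
    by simp
  have 2: "fib_poly (2 * Suc n + 2) = fib_poly (2 * Suc n + 1) + [:0, 1:] * fib_poly (2 * n + 2)"
    by simp
  have a: "\<forall>i>Suc n. coeff (fib_poly (2 * Suc n + 1)) i = 0" "coeff (fib_poly (2 * Suc n + 1)) (Suc n) = 1"
    unfolding 1 using Suc by (auto simp: coeff_pCons simp del: fib_poly.simps split: nat.splits)
  moreover have "\<forall>i>Suc n. coeff (fib_poly (2 * Suc n + 2)) i = 0"
    unfolding 2 using a Suc by (auto simp: coeff_pCons simp del: fib_poly.simps split: nat.splits)
  ultimately show ?case by blast
qed

lemma fib_poly_odd: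
  shows degree_fib_poly_odd: "degree (fib_poly (2 * n + 1)) = n"
    and lead_fib_poly_odd: "coeff (fib_poly (2 * n + 1)) n = 1"
proof -
  show l: "coeff (fib_poly (2 * n + 1)) n = 1"
    using coeff_fib_poly_odd_even[of n] by blast
  show "degree (fib_poly (2 * n + 1)) = n"
  proof (rule antisym)
    show "degree (fib_poly (2 * n + 1)) \<le> n"
      by (rule degree_le) (use coeff_fib_poly_odd_even[of n] in blast)
    show "n \<le> degree (fib_poly (2 * n + 1))"
      by (rule le_degree) (use l in simp)
  qed
qed

lemma poly_functional_fib_unique:
  assumes f: "poly_functional f" and g: "poly_functional g"
    and eq: "\<And>n. f (fib_poly (2 * n + 1)) = g (fib_poly (2 * n + 1))"
  shows "f = g"
proof
  fix p
  have fa: "f (p + q) = f p + f q" "f (smult c p) = c * f p" for p q c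
    using f by (auto simp: poly_functional_iff)
  have ga: "g (p + q) = g p + g q" "g (smult c p) = c * g p" for p q c
    using g by (auto simp: poly_functional_iff)
  have z: "f 0 = 0" "g 0 = 0" using fa(2)[of 0 0] ga(2)[of 0 0] by auto
  have "\<forall>i\<ge>m. coeff p i = 0 \<Longrightarrow> f p = g p" for m
  proof (induction m arbitrary: p)
    case 0
    then have "p = 0" by (intro poly_eqI) auto
    then show ?case using z by simp
  next
    case (Suc m)
    define B where "B = fib_poly (2 * m + 1)"
    define q where "q = p + smult (- coeff p m) B"
    have B: "coeff B m = 1" "\<And>i. i > m \<Longrightarrow> coeff B i = 0"
      using coeff_fib_poly_odd_even[of m] by (auto simp: B_def simp del: fib_poly.simps)
    have "\<forall>i\<ge>m. coeff q i = 0"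
    proof (intro allI impI)
      fix i assume "m \<le> i"
      then show "coeff q i = 0"
        using Suc.prems B by (cases "i = m") (auto simp: q_def)
    qed
    then have "f q = g q" by (rule Suc.IH)
    moreover have "f q = f p + - coeff p m * f B" "g q = g p + - coeff p m * g B"
      by (simp_all only: q_def fa ga)
    moreover have "f B = g B" unfolding B_def by (rule eq)
    ultimately show ?case by simp
  qed
  from this[of "Suc (degree p)"] show "f p = g p"
    by (simp add: coeff_eq_0)
qed

lemma poly_functional_fib_exists:
  fixes t :: "nat \<Rightarrow> real"
  shows "\<exists>f. poly_functional f \<and> (\<forall>n. f (fib_poly (2 * n + 1)) = t n)"
proof -
  have "\<exists>a :: nat \<Rightarrow> real. \<forall>n. a n = t n - (\<Sum>j<n. coeff (fib_poly (2 * n + 1)) j * a j)"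
  proof -
    define a where "a = wfrec less_than
      (\<lambda>a n. t n - (\<Sum>j<n. coeff (fib_poly (2 * n + 1)) j * a j))"
    have "a n = t n - (\<Sum>j<n. coeff (fib_poly (2 * n + 1)) j * a j)" for n
      unfolding a_def by (subst wfrec) (auto simp: cut_apply simp del: fib_poly.simps)
    then show ?thesis by blast
  qed
  then obtain a :: "nat \<Rightarrow> real"
    where a: "\<And>n. a n = t n - (\<Sum>j<n. coeff (fib_poly (2 * n + 1)) j * a j)" by blast
  define f where "f = (\<lambda>p. \<Sum>j\<le>degree p. coeff p j * a j)"
  have f_eq: "f p = (\<Sum>j\<le>m. coeff p j * a j)" if "degree p \<le> m" for p m
    unfolding f_def by (rule sum.mono_neutral_left) (use that in \<open>auto simp: coeff_eq_0\<close>)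
  have "f (p + q) = f p + f q" for p q
  proof -
    define m where "m = max (degree p) (degree q)"
    have "degree (p + q) \<le> m" "degree p \<le> m" "degree q \<le> m"
      using degree_add_le_max[of p q] by (auto simp: m_def)
    then show ?thesis
      by (simp add: f_eq sum.distrib distrib_right)
  qed
  moreover have "f (smult c p) = c * f p" for c p
    by (simp add: f_eq[of _ "degree p"] degree_smult_le sum_distrib_left mult.assoc)
  moreover have "f (fib_poly (2 * n + 1)) = t n" for n
  proof -
    have "f (fib_poly (2 * n + 1)) = (\<Sum>j\<le>n. coeff (fib_poly (2 * n + 1)) j * a j)"
      by (rule f_eq) (simp only: degree_fib_poly_odd)
    also have "\<dots> = (\<Sum>j<n. coeff (fib_poly (2 * n + 1)) j * a j) + a n"
      by (simp only: lessThan_Suc_atMost[symmetric] sum.lessThan_Suc lead_fib_poly_odd mult_1)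
    finally show ?thesis using a[of n] by linarith
  qed
  ultimately show ?thesis by (auto simp: poly_functional_iff simp del: fib_poly.simps)
qed

lemma phi_ex1:
  "\<exists>!f. poly_functional f \<and>
     (\<forall>n\<ge>1. f (fib_poly (2 * n - 1)) = real (central_factorial n k))"
proof -
  have shift: "(\<forall>n\<ge>1. f (fib_poly (2 * n - 1)) = real (central_factorial n k)) \<longleftrightarrow>
      (\<forall>n. f (fib_poly (2 * n + 1)) = real (central_factorial (Suc n) k))"
    (is "?L \<longleftrightarrow> ?R") for f
  proof
    assume L: ?L
    show ?R
    proof
      fix n
      show "f (fib_poly (2 * n + 1)) = real (central_factorial (Suc n) k)"
        using L[rule_format, of "Suc n"] by simp
    qed
  next
    assume R: ?R
    show ?L
    proof (intro allI impI)
      fix n :: nat assume "1 \<le> n"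
      then obtain m where "n = Suc m" by (cases n) auto
      then show "f (fib_poly (2 * n - 1)) = real (central_factorial n k)"
        using R[rule_format, of m] by simp
    qed
  qed
  show ?thesis unfolding shift
    using poly_functional_fib_exists[of "\<lambda>n. real (central_factorial (Suc n) k)"]
      poly_functional_fib_unique by (metis (no_types, lifting))
qed

lemma
  shows poly_functional_phi: "poly_functional (phi k)"
    and phi_fib_poly: "n \<ge> 1 \<Longrightarrow> phi k (fib_poly (2 * n - 1)) = real (central_factorial n k)"
  using theI'[OF phi_ex1[of k]] unfolding phi_def by blast+

end

(* The functional sending s^n to LS(n,k) turns multiplication by s into the recurrence of LS, and
   with F_{m+2} = F_{m+1} + s F_m this yields, by induction on n, the values T(n+1,k+1) and
   (k+1) T(n+1,k+1) on F_{2n+1} and F_{2n+2}.  The values on the odd-indexed polynomials determine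
   the functional, so it is phi_{k+1}. *)

theory Submission
  imports Defs
begin

text \<open>The Fibonacci recurrence on coefficients is Pascal's rule. For \<open>j > m\<close>
  truncated subtraction gives \<open>0 choose j\<close> with positive \<open>j\<close>, so no range
  restriction on \<open>j\<close> is needed.\<close>

lemma coeff_fib_poly: "coeff (fib_poly (Suc m)) j = real ((m - j) choose j)"
proof (induction m arbitrary: j rule: less_induct)
  case (less m)
  consider "m = 0" | "m = 1" | l where "m = Suc (Suc l)"
    by (metis One_nat_def not0_implies_Suc)
  then show ?case
  proof cases
    case 3
    show ?thesis
    proof (cases j)
      case 0
      then show ?thesis using less[of "Suc l" 0] 3 by simp
    next
      case (Suc i)
      have "coeff (fib_poly (Suc m)) j = real ((Suc l - j) choose j) + real ((l - i) choose i)"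
        using less[of "Suc l" j] less[of l i] 3 Suc by simp
      also have "\<dots> = real ((m - j) choose j)"
      proof (cases "i \<le> l")
        case True
        then have "m - j = Suc (l - i)" "Suc l - j = l - i" using 3 Suc by auto
        then show ?thesis using Suc by simp
      \<comment> \<open>For \<open>i > l\<close> all three upper indices truncate to 0 while the
        lower ones are positive, so both sides vanish.\<close>
      qed (use 3 Suc in auto)
      finally show ?thesis .
    qed
  qed (auto simp: coeff_pCons split: nat.splits)
qed

definition monom_functional :: "(nat \<Rightarrow> real) \<Rightarrow> real poly \<Rightarrow> real" where
  "monom_functional a p = (\<Sum>j\<le>degree p. coeff p j * a j)"

text \<open>Padding with zero coefficients gives several polynomials a common summation range;
  additivity needs this because degrees can differ or drop under addition.\<close>

lemma monom_functional_eq: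
  assumes "degree p \<le> m"
  shows "monom_functional a p = (\<Sum>j\<le>m. coeff p j * a j)"
  unfolding monom_functional_def
  by (rule sum.mono_neutral_left) (use assms in \<open>auto simp: coeff_eq_0\<close>)

lemma monom_functional_add:
  "monom_functional a (p + q) = monom_functional a p + monom_functional a q"
proof -
  define m where "m = max (degree p) (degree q)"
  have "degree (p + q) \<le> m" "degree p \<le> m" "degree q \<le> m"
    using degree_add_le_max[of p q] by (auto simp: m_def)
  then show ?thesis
    by (simp add: monom_functional_eq[of _ m] sum.distrib distrib_right)
qed

lemma monom_functional_smult: "monom_functional a (smult c p) = c * monom_functional a p"
  by (simp add: monom_functional_eq[of _ "degree p"] degree_smult_le sum_distrib_left mult.assoc)

lemma poly_functional_monom_functional: "poly_functional (monom_functional a)"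
  by (simp add: poly_functional_iff monom_functional_add monom_functional_smult)

lemma monom_functional_power: "monom_functional a ([:0, 1:] ^ n) = a n"
  by (simp add: monom_functional_def monom_altdef[of 1, simplified, symmetric] degree_monom_eq
      if_distrib[of "\<lambda>x. x * _"] cong: if_cong)

text \<open>\<open>pCons 0 p\<close> is s times p, so multiplication by s is dual to shifting
  \<open>a\<close>. A recurrence for \<open>a\<close> thereby becomes a rule for the
  functional.\<close>

lemma monom_functional_pCons_0:
  "monom_functional a (pCons 0 p) = monom_functional (\<lambda>j. a (Suc j)) p"
proof -
  have "degree (pCons 0 p) \<le> Suc (degree p)" by (simp add: degree_pCons_le)
  then show ?thesis
    by (simp add: monom_functional_eq[of _ "Suc (degree p)"] sum.atMost_Suc_shift
        monom_functional_def[of "\<lambda>j. a (Suc j)"] del: sum.atMost_Suc)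
qed

lemma monom_functional_fib_poly:
  assumes "n \<le> m" and "m \<le> 2 * n + 1"
  shows "monom_functional a (fib_poly (Suc m)) = (\<Sum>j=0..n. real ((m - j) choose j) * a j)"
proof -
  have "degree (fib_poly (Suc m)) \<le> n"
    \<comment> \<open>For \<open>j > n\<close> the bound \<open>m <= 2 * n + 1\<close> gives
      \<open>m - j < j\<close>, so the binomial is zero.\<close>
    by (rule degree_le) (use assms in \<open>auto simp: coeff_fib_poly\<close>)
  then show ?thesis
    by (simp add: monom_functional_eq coeff_fib_poly atMost_atLeast0 del: fib_poly.simps)
qed

abbreviation ls_functional :: "nat \<Rightarrow> real poly \<Rightarrow> real" where
  "ls_functional k \<equiv> monom_functional (\<lambda>j. real (legendre_stirling j k))"

lemma ls_functional_pCons_0: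
  "ls_functional 0 (pCons 0 p) = 0"
  "ls_functional (Suc k) (pCons 0 p) =
     ls_functional k p + real (Suc k) * real (k + 2) * ls_functional (Suc k) p"
  by (simp_all add: monom_functional_pCons_0)
    (simp_all add: monom_functional_def sum.distrib sum_distrib_left algebra_simps)

text \<open>The two parities feed each other through the Fibonacci recurrence, hence one joint
  induction; \<open>k\<close> stays arbitrary because multiplication by s also brings in
  \<open>k - 1\<close>.\<close>

lemma ls_functional_fib_poly:
  "ls_functional k (fib_poly (2 * n + 1)) = real (central_factorial (n + 1) (k + 1)) \<and>
   ls_functional k (fib_poly (2 * n + 2)) = real (k + 1) * real (central_factorial (n + 1) (k + 1))"
proof (induction n arbitrary: k)
  case 0
  show ?case by (cases k) (auto simp: monom_functional_def numeral_2_eq_2)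
next
  case (Suc n)
  have step: "fib_poly (2 * Suc n + 1) = fib_poly (2 * n + 2) + pCons 0 (fib_poly (2 * n + 1))"
    "fib_poly (2 * Suc n + 2) = fib_poly (2 * Suc n + 1) + pCons 0 (fib_poly (2 * n + 2))"
    by simp_all
  note IH = Suc.IH[THEN conjunct1] Suc.IH[THEN conjunct2]
  have rec: "real (central_factorial (Suc n + 1) (k + 1)) = real (central_factorial (n + 1) k) +
      (real (k + 1))\<^sup>2 * real (central_factorial (n + 1) (k + 1))"
    by (simp del: of_nat_Suc)
  \<comment> \<open>For \<open>k = 0\<close> the functional kills multiples of s, which matches this
    vanishing term of \<open>rec\<close>.\<close>
  have zero: "central_factorial (n + 1) 0 = 0" by simp
  have odd: "ls_functional k (fib_poly (2 * Suc n + 1)) =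
      real (central_factorial (Suc n + 1) (k + 1))"
  proof (cases k)
    case 0
    then show ?thesis
      unfolding rec unfolding step monom_functional_add 0 ls_functional_pCons_0 IH zero by simp
  next
    case (Suc l)
    \<comment> \<open>The coefficients of T(n+1,k+1) combine as (k+1) + k(k+1) = (k+1)^2.\<close>
    show ?thesis
      unfolding rec unfolding step monom_functional_add Suc ls_functional_pCons_0 IH
      by (simp add: algebra_simps power2_eq_square del: central_factorial.simps)
  qed
  moreover have "ls_functional k (fib_poly (2 * Suc n + 2)) =
      real (k + 1) * real (central_factorial (Suc n + 1) (k + 1))"
  proof (cases k)
    case 0
    then show ?thesis
      unfolding step(2) monom_functional_add odd unfolding 0 ls_functional_pCons_0 by simp
  next
    case (Suc l)
    \<comment> \<open>The multiple of s contributes k T(n+1,k) + k(k+1)^2 T(n+1,k+1) = k T(n+2,k+1),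
      which the odd value T(n+2,k+1) raises to the factor k+1.\<close>
    show ?thesis
      unfolding step(2) monom_functional_add odd rec
      unfolding Suc ls_functional_pCons_0 IH
      by (simp add: algebra_simps power2_eq_square del: central_factorial.simps)
  qed
  ultimately show ?case by blast
qed

lemma phi_eq_ls_functional: "phi (k + 1) = ls_functional k"
proof (rule poly_functional_fib_unique)
  fix n
  show "phi (k + 1) (fib_poly (2 * n + 1)) = ls_functional k (fib_poly (2 * n + 1))"
    \<comment> \<open>\<open>phi\<close> is specified at index \<open>2 * n - 1\<close> with n at
      least 1, hence the shift to \<open>Suc n\<close>.\<close>
    using phi_fib_poly[of "Suc n" "k + 1"] ls_functional_fib_poly[of k n] by simp
qed (rule poly_functional_phi poly_functional_monom_functional)+

theorem theorem4p4:
  fixes n k :: nat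
  shows
    "phi (k + 1) ([:0, 1:] ^ n) = real (legendre_stirling n k) \<and>
     phi (k + 1) (fib_poly (2 * n + 1)) =
       (\<Sum>j=0..n. real ((2 * n - j) choose j) * real (legendre_stirling j k)) \<and>
     (\<Sum>j=0..n. real ((2 * n - j) choose j) * real (legendre_stirling j k)) =
       real (central_factorial (n + 1) (k + 1)) \<and>
     phi (k + 1) (fib_poly (2 * n + 2)) =
       (\<Sum>j=0..n. real ((2 * n + 1 - j) choose j) * real (legendre_stirling j k)) \<and>
     (\<Sum>j=0..n. real ((2 * n + 1 - j) choose j) * real (legendre_stirling j k)) =
       real (k + 1) * real (central_factorial (n + 1) (k + 1))"
proof -
  let ?a = "\<lambda>j. real (legendre_stirling j k)"
  have "ls_functional k (fib_poly (2 * n + 1)) = (\<Sum>j=0..n. real ((2 * n - j) choose j) * ?a j)"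
    using monom_functional_fib_poly[of n "2 * n" ?a] by simp
  moreover have "ls_functional k (fib_poly (2 * n + 2)) =
      (\<Sum>j=0..n. real ((2 * n + 1 - j) choose j) * ?a j)"
    using monom_functional_fib_poly[of n "2 * n + 1" ?a] by simp
  ultimately show ?thesis
    using ls_functional_fib_poly[of k n]
    by (simp only: phi_eq_ls_functional monom_functional_power)
qed

end
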